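(* Given pairwise distinct non-zero velocities $v_1,v_2,v_3\in\mathbb{R}$ and arbitrary starting points $s_1,s_2,s_3\in\mathbb{R}$, there is a real number $t$ such that for all $1\le j\le 3$ the distance of $s_j+tv_j$ to the nearest integer is at least $\frac14$. Moreover, the only extremal velocity vector (up to scaling and permuting coordinates) is $v=(1,2,3)$.
   Context: In the second assertion, a velocity vector is a vector $v=(v_1,v_2,v_3)\in\mathbb{Z}_{>0}^3$ with pairwise distinct entries. It is called extremal if the bound $\frac14$ cannot be improved for $v$: there exist starting points $s_1,s_2,s_3\in\mathbb{R}$ for which no real $t$ makes the distance of $s_j+tv_j$ to the nearest integer strictly greater than $\frac14$ for all $j=1,2,3$ simultaneously.
   Formalization: In the first assertion the velocities are also assumed pairwise non-opposite (v_i ≠ -v_j), since the claim fails for v=(1,-1,2) with starting points (0,1/2,1/2); the condition holds automatically for distinct positive velocities. *)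

theory Defs
  imports "HOL-Analysis.Analysis" "HOL-Combinatorics.Permutations"
begin

definition nearest_int_dist :: "real \<Rightarrow> real" where
  "nearest_int_dist x = \<bar>x - of_int (round x)\<bar>"

definition velocity_vector :: "int ^ 3 \<Rightarrow> bool" where
  "velocity_vector v \<longleftrightarrow> (\<forall>j. v $ j > 0) \<and> (\<forall>i j. i \<noteq> j \<longrightarrow> v $ i \<noteq> v $ j)"

definition extremal :: "int ^ 3 \<Rightarrow> bool" where
  "extremal v \<longleftrightarrow>
     (\<exists>s :: real ^ 3. \<nexists>t :: real. \<forall>j. nearest_int_dist (s $ j + t * of_int (v $ j)) > 1 / 4)"

definition eq_up_to_scaling_permuting :: "int ^ 3 \<Rightarrow> int ^ 3 \<Rightarrow> bool" where
  "eq_up_to_scaling_permuting v w \<longleftrightarrow>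
     (\<exists>c :: real. c > 0 \<and>
        (\<exists>\<sigma>. \<sigma> permutes UNIV \<and> (\<forall>j. real_of_int (v $ j) = c * real_of_int (w $ \<sigma> j))))"

text \<open>
  For real velocities of arbitrary sign, being pairwise distinct and non-zero does not suffice for
  the bound 1/4: opposite velocities behave like equal ones, since the distance to the nearest
  integer is even. The following instance shows why velocities must also not be opposite to each
  other; for positive velocities that condition is vacuous.
\<close>

lemma opposite_velocities_counterexample:
  fixes t :: real
  shows "\<not> (nearest_int_dist (0 + t * 1) \<ge> 1 / 4 \<and>
            nearest_int_dist (1 / 2 + t * (- 1)) \<ge> 1 / 4 \<and>
            nearest_int_dist (1 / 2 + t * 2) \<ge> 1 / 4)"
proof
  assume *: "nearest_int_dist (0 + t * 1) \<ge> 1 / 4 \<and>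
            nearest_int_dist (1 / 2 + t * (- 1)) \<ge> 1 / 4 \<and>
            nearest_int_dist (1 / 2 + t * 2) \<ge> 1 / 4"
  have le: "nearest_int_dist x \<le> \<bar>x - of_int m\<bar>" for x m
    unfolding nearest_int_dist_def by (rule round_diff_minimal)
  define n where "n = round t"
  define u where "u = t - of_int n"
  have u: "\<bar>u\<bar> \<le> 1 / 2" "\<bar>u\<bar> \<ge> 1 / 4"
    using of_int_round_abs_le[of t] * by (auto simp: u_def n_def nearest_int_dist_def abs_minus_commute)
  have "\<bar>1 / 2 - u\<bar> \<ge> 1 / 4" "\<bar>1 / 2 + u\<bar> \<ge> 1 / 4"
    using * le[of "1 / 2 + t * (- 1)" "- n"] le[of "1 / 2 + t * (- 1)" "1 - n"]
    unfolding u_def of_int_minus of_int_diff of_int_1 by linarith+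
  with u have u': "u = 1 / 4 \<or> u = - 1 / 4" by linarith
  have eq: "1 / 2 + t * 2 - of_int (2 * n + 1) = 2 * u - 1 / 2"
    "1 / 2 + t * 2 - of_int (2 * n) = 2 * u + 1 / 2"
    by (simp_all add: u_def)
  have "\<bar>2 * u - 1 / 2\<bar> \<ge> 1 / 4" "\<bar>2 * u + 1 / 2\<bar> \<ge> 1 / 4"
    using * le[of "1 / 2 + t * 2" "2 * n + 1", unfolded eq] le[of "1 / 2 + t * 2" "2 * n", unfolded eq]
      order_trans by blast+
  with u' show False by auto
qed

end

theory Submission
  imports Defs
begin

text \<open>
  Put $p_j(t) = 2(s_j + t v_j) - 1/2$, so that runner $j$ is at distance at least $1/4$ (more than
  $1/4$) from the integers iff $\sin(\pi p_j(t)) \ge 0$ ($> 0$). Dirichlet approximation yields a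
  nonempty set $P$ of runners and arbitrarily good approximate half-periods: shifts of time that
  flip the sign of exactly the sines in $P$. Hence a time at which the sines in $P$ are negative and
  the others positive can be traded for a strict solution.

  Take all $v_j > 0$ and let $u_j = 2 v_j$ be the slopes. For $u_1 < u_2$ there is an $n$ such that $p_2(t) \in (n, n + 1)$ forces
  $p_1(t) \in (n, n + 1)$, so both sines agree for as long as $1/u_2$; any third runner with
  $u_3 > u_2$ takes both signs in that time. This settles everything except $P = \{1, 2\}$ with
  $u_1, u_3 < u_2$. If there is no strict solution there, the sines of runners 1 and 2 have
  opposite signs whenever the third is positive, so each zero of the second during such a phase is
  also a zero of the first, which is a weak solution. As these common zeros meet every positive
  phase of the third runner, comparing the spacings forces $u = (g, 3g, 2g)$.
\<close>

section \<open>Signs of \<open>sin (pi * x)\<close> and the distance to the nearest integer\<close>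

lemma sin_pi_int_add:
  "sin (pi * (of_int n + x)) = (if even n then sin (pi * x) else - sin (pi * x))"
proof (cases "even n")
  case True
  then obtain k where "n = 2 * k" by (elim evenE)
  then have eq: "pi * (of_int n + x) = pi * x + (2 * pi) * of_int k"
    by (simp add: algebra_simps)
  have "sin (pi * (of_int n + x)) = sin (pi * x)"
    unfolding eq sin_add sin_int_2pin cos_int_2pin by simp
  with True show ?thesis by simp
next
  case False
  then obtain k where "n = 2 * k + 1" by (elim oddE)
  then have eq: "pi * (of_int n + x) = (pi * x + pi) + (2 * pi) * of_int k"
    by (simp add: algebra_simps)
  have "sin (pi * (of_int n + x)) = - sin (pi * x)"
    unfolding eq sin_add[of "pi * x + pi"] sin_int_2pin cos_int_2pin by simp
  with False show ?thesis by simp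
qed

lemma sin_pi_pos: "0 < x \<Longrightarrow> x < 1 \<Longrightarrow> sin (pi * x) > 0"
  by (rule sin_gt_zero) auto

lemma sin_pi_sign:
  assumes "of_int n < x" "x < of_int n + 1"
  shows "if even n then sin (pi * x) > 0 else sin (pi * x) < 0"
  using sin_pi_int_add[of n "x - of_int n"] sin_pi_pos[of "x - of_int n"] assms by auto

lemma sin_pi_eq_0: "sin (pi * x) = 0 \<longleftrightarrow> x \<in> \<int>"
  by (auto simp: sin_zero_iff_int2 Ints_def field_simps)

text \<open>The sine equals \<open>- cos (2 * pi * x)\<close>, which depends only on the distance of
  \<open>x\<close> to the nearest integer and changes sign at distance 1/4.\<close>

lemma nearest_int_dist_sin:
  "nearest_int_dist x \<ge> 1 / 4 \<longleftrightarrow> sin (pi * (2 * x - 1 / 2)) \<ge> 0"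
  "nearest_int_dist x > 1 / 4 \<longleftrightarrow> sin (pi * (2 * x - 1 / 2)) > 0"
proof -
  define y where "y = x - of_int (round x)"
  have y: "\<bar>y\<bar> \<le> 1 / 2"
    using of_int_round_abs_le[of x] by (simp add: y_def abs_minus_commute)
  have d: "nearest_int_dist x = \<bar>y\<bar>" by (simp add: nearest_int_dist_def y_def)
  have "sin (pi * (2 * x - 1 / 2)) = sin (pi * (2 * y - 1 / 2))"
    using sin_pi_int_add[of "2 * round x" "2 * y - 1 / 2"] by (simp add: y_def algebra_simps)
  also have "\<dots> = sin (pi * (2 * \<bar>y\<bar> - 1 / 2))"
    by (cases "y \<ge> 0") (auto simp: algebra_simps sin_diff)
  finally have eq: "sin (pi * (2 * x - 1 / 2)) = sin (pi * (2 * \<bar>y\<bar> - 1 / 2))" .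
  have neg: "sin (pi * (2 * \<bar>y\<bar> - 1 / 2)) < 0" if "\<bar>y\<bar> < 1 / 4"
    using sin_pi_sign[of "-1" "2 * \<bar>y\<bar> - 1 / 2"] that by simp
  have pos: "sin (pi * (2 * \<bar>y\<bar> - 1 / 2)) > 0" if "\<bar>y\<bar> > 1 / 4"
    using sin_pi_sign[of "0" "2 * \<bar>y\<bar> - 1 / 2"] that y by simp
  have zero: "sin (pi * (2 * \<bar>y\<bar> - 1 / 2)) = 0" if "\<bar>y\<bar> = 1 / 4"
    unfolding that by simp
  show "nearest_int_dist x \<ge> 1 / 4 \<longleftrightarrow> sin (pi * (2 * x - 1 / 2)) \<ge> 0"
    "nearest_int_dist x > 1 / 4 \<longleftrightarrow> sin (pi * (2 * x - 1 / 2)) > 0"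
    unfolding eq d using neg pos zero by (smt (verit))+
qed

section \<open>Phases of two or three runners compared over short time windows\<close>

text \<open>As a function of the faster phase, the slower phase is an affine map of slope
  \<open>u1 / u2 < 1\<close>. It maps a unit interval \<open>[n, n + 1]\<close> around its fixed
  point into itself.\<close>

lemma nested_unit_interval:
  fixes r1 r2 u1 u2 :: real
  assumes "0 < u1" "u1 < u2"
  obtains n :: int where
    "\<And>t. of_int n < r2 + u2 * t \<Longrightarrow> r2 + u2 * t < of_int n + 1 \<Longrightarrow>
      of_int n < r1 + u1 * t \<and> r1 + u1 * t < of_int n + 1"
proof -
  define \<rho> where "\<rho> = u1 / u2"
  have \<rho>: "0 < \<rho>" "\<rho> < 1" using assms by (auto simp: \<rho>_def)
  \<comment> \<open>When \<open>p2\<close> enters \<open>(n, n + 1)\<close>, the lead \<open>p1 - p2\<close> is \<open>(r1 - \<rho> * r2) - n * (1 - \<rho>)\<close>; it has to lie in \<open>[0, 1 - \<rho>]\<close>.\<close>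
  define n where "n = \<lfloor>(r1 - \<rho> * r2) / (1 - \<rho>)\<rfloor>"
  have "of_int n \<le> (r1 - \<rho> * r2) / (1 - \<rho>)" "(r1 - \<rho> * r2) / (1 - \<rho>) \<le> of_int n + 1"
    unfolding n_def by linarith+
  then have n: "of_int n * (1 - \<rho>) \<le> r1 - \<rho> * r2" "r1 - \<rho> * r2 \<le> (of_int n + 1) * (1 - \<rho>)"
    using \<rho> by (simp_all add: le_divide_eq divide_le_eq)
  show thesis
  proof
    fix t assume t: "of_int n < r2 + u2 * t" "r2 + u2 * t < of_int n + 1"
    have "\<rho> * of_int n < \<rho> * (r2 + u2 * t)" "\<rho> * (r2 + u2 * t) < \<rho> * (of_int n + 1)"
      using t \<rho> by simp_all
    moreover have "r1 + u1 * t = r1 - \<rho> * r2 + \<rho> * (r2 + u2 * t)"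
      using assms by (simp add: \<rho>_def algebra_simps)
    ultimately show "of_int n < r1 + u1 * t \<and> r1 + u1 * t < of_int n + 1"
      using n by (auto simp: algebra_simps)
  qed
qed

text \<open>The closed phase intervals without positive sine have length 1, so a longer phase
  interval cannot fit into one of them.\<close>

lemma long_interval_sin_pos:
  fixes r u x y :: real
  assumes "u > 0" "1 < u * (y - x)"
  obtains t where "x < t" "t < y" "sin (pi * (r + u * t)) > 0"
proof -
  define \<alpha> \<beta> where "\<alpha> = r + u * x" and "\<beta> = r + u * y"
  have ab: "\<beta> - \<alpha> > 1" using assms by (simp add: \<alpha>_def \<beta>_def algebra_simps)
  \<comment> \<open>\<open>2 * k\<close> starts the period of the sine that contains
    \<open>\<alpha>\<close>. The point \<open>p\<close> is sought in the positive half of this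
    period or, if \<open>\<alpha>\<close> is already past it, in that of the next one.\<close>
  define k where "k = \<lfloor>\<alpha> / 2\<rfloor>"
  have k: "2 * of_int k \<le> \<alpha>" "\<alpha> < 2 * of_int k + 2"
    unfolding k_def by linarith+
  have "\<exists>p m::int. even m \<and> \<alpha> < p \<and> p < \<beta> \<and> of_int m < p \<and> p < of_int m + 1"
  proof (cases "\<alpha> < 2 * of_int k + 1")
    case True
    show ?thesis
      by (rule exI[of _ "(\<alpha> + min \<beta> (2 * of_int k + 1)) / 2"], rule exI[of _ "2 * k"])
        (use k ab True in \<open>auto simp: min_def\<close>)
  next
    case False
    show ?thesis
      by (rule exI[of _ "(2 * of_int k + 2 + min \<beta> (2 * of_int k + 3)) / 2"], rule exI[of _ "2 * k + 2"])
        (use k ab False in \<open>auto simp: min_def\<close>)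
  qed
  then obtain p m where p: "even m" "\<alpha> < p" "p < \<beta>" "of_int m < p" "p < of_int m + 1"
    by blast
  then have "sin (pi * p) > 0" using sin_pi_sign[of m p] by simp
  moreover have "r + u * ((p - r) / u) = p" using assms by simp
  moreover have "x < (p - r) / u" "(p - r) / u < y"
    using p assms by (auto simp: \<alpha>_def \<beta>_def field_simps)
  ultimately show thesis using that by metis
qed

lemma long_interval_sin_neg:
  fixes r u x y :: real
  assumes "u > 0" "1 < u * (y - x)"
  obtains t where "x < t" "t < y" "sin (pi * (r + u * t)) < 0"
proof -
  obtain t where "x < t" "t < y" "sin (pi * ((1 + r) + u * t)) > 0"
    using long_interval_sin_pos[OF assms] .
  moreover have "sin (pi * ((1 + r) + u * t)) = - sin (pi * (r + u * t))"
    using sin_pi_int_add[of 1 "r + u * t"] by (simp add: add.assoc)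
  ultimately show thesis using that by auto
qed

text \<open>In the window from \<open>nested_unit_interval\<close> the two slower sines share a
  constant sign, and its duration \<open>1 / u2\<close> lets the third sine take both signs. The
  first claim serves a set \<open>P\<close> of the two slower runners, the second the set of all
  three.\<close>

lemma two_slow_agree:
  fixes r1 r2 r3 u1 u2 u3 :: real
  assumes "0 < u1" "u1 < u2" "u2 < u3"
  shows "\<exists>t. sin (pi * (r1 + u1 * t)) * sin (pi * (r2 + u2 * t)) > 0 \<and> sin (pi * (r3 + u3 * t)) > 0"
    and "\<exists>t. sin (pi * (r1 + u1 * t)) * sin (pi * (r2 + u2 * t)) > 0 \<and>
             sin (pi * (r1 + u1 * t)) * sin (pi * (r3 + u3 * t)) > 0"
proof -
  obtain n :: int where n: "\<And>t. of_int n < r2 + u2 * t \<Longrightarrow> r2 + u2 * t < of_int n + 1 \<Longrightarrow>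
      of_int n < r1 + u1 * t \<and> r1 + u1 * t < of_int n + 1"
    using nested_unit_interval[OF assms(1,2)] by blast
  define x y where "x = (of_int n - r2) / u2" and "y = (of_int n + 1 - r2) / u2"
  have "y - x = 1 / u2" by (simp add: x_def y_def diff_divide_distrib[symmetric])
  then have len: "1 < u3 * (y - x)" using assms by simp
  have in12: "(if even n then sin (pi * (r1 + u1 * t)) > 0 \<and> sin (pi * (r2 + u2 * t)) > 0
      else sin (pi * (r1 + u1 * t)) < 0 \<and> sin (pi * (r2 + u2 * t)) < 0)"
    if "x < t" "t < y" for t
  proof -
    have "of_int n < r2 + u2 * t" "r2 + u2 * t < of_int n + 1"
      using that assms by (auto simp: x_def y_def field_simps)
    with n[of t] show ?thesis
      using sin_pi_sign[of n "r1 + u1 * t"] sin_pi_sign[of n "r2 + u2 * t"] by auto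
  qed
  obtain t where t: "x < t" "t < y" "sin (pi * (r3 + u3 * t)) > 0"
    using long_interval_sin_pos[OF _ len] assms by auto
  obtain t' where t': "x < t'" "t' < y" "sin (pi * (r3 + u3 * t')) < 0"
    using long_interval_sin_neg[OF _ len] assms by auto
  show "\<exists>t. sin (pi * (r1 + u1 * t)) * sin (pi * (r2 + u2 * t)) > 0 \<and> sin (pi * (r3 + u3 * t)) > 0"
    using t in12[of t] by (auto simp: zero_less_mult_iff split: if_splits)
  \<comment> \<open>The witness is \<open>t\<close> for even \<open>n\<close> and \<open>t'\<close>
    for odd \<open>n\<close>.\<close>
  show "\<exists>t. sin (pi * (r1 + u1 * t)) * sin (pi * (r2 + u2 * t)) > 0 \<and>
             sin (pi * (r1 + u1 * t)) * sin (pi * (r3 + u3 * t)) > 0"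
    using t t' in12[of t] in12[of t'] by (auto simp: zero_less_mult_iff split: if_splits)
qed

section \<open>Approximate half-periods from simultaneous Dirichlet approximation\<close>

text \<open>A common multiplier \<open>q\<close> brings all \<open>q * u j\<close> close to integers
  \<open>w j\<close>. Dividing by their gcd \<open>d\<close> makes some quotient odd without
  enlarging the errors; \<open>P\<close> collects the runners with odd quotient, and
  \<open>\<tau>\<close> is \<open>q / d\<close>.\<close>

lemma approx_half_period_at:
  fixes u :: "'n :: finite \<Rightarrow> real"
  assumes "u i \<noteq> 0" "\<epsilon> > 0"
  shows "\<exists>P. P \<noteq> {} \<and> (\<exists>\<tau>. \<forall>j. \<exists>m::int. \<bar>u j * \<tau> - (2 * of_int m + (if j \<in> P then 1 else 0))\<bar> < \<epsilon>)"
proof -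
  obtain f where f: "bij_betw f {0..<CARD('n)} (UNIV :: 'n set)"
    using ex_bij_betw_nat_finite[of "UNIV :: 'n set"] by auto
  \<comment> \<open>The bound \<open>\<bar>u i\<bar>\<close> forces \<open>w i\<close> to be
    nonzero, so that the gcd is positive: otherwise
    \<open>q * \<bar>u i\<bar> < \<bar>u i\<bar>\<close> although \<open>q \<ge> 1\<close>.\<close>
  define \<delta> where "\<delta> = min \<epsilon> \<bar>u i\<bar>"
  have "\<delta> > 0" using assms by (simp add: \<delta>_def)
  then obtain N :: nat where N: "N > 0" "1 / N < \<delta>"
    using real_arch_inverse[of \<delta>] by (auto simp: inverse_eq_divide)
  obtain q p where q: "0 < q"
    and p: "\<And>k. k < CARD('n) \<Longrightarrow> \<bar>of_int q * (u \<circ> f) k - of_int (p k)\<bar> < 1 / N"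
    using Dirichlet_approx_simult[OF N(1), of "CARD('n)" "u \<circ> f"] by metis
  \<comment> \<open>Dirichlet's theorem numbers the reals by naturals; \<open>w\<close> carries the
    numerators back along \<open>f\<close>.\<close>
  define w where "w j = p (inv_into {0..<CARD('n)} f j)" for j
  have w: "\<bar>of_int q * u j - of_int (w j)\<bar> < \<delta>" for j
  proof -
    have "inv_into {0..<CARD('n)} f j \<in> {0..<CARD('n)}"
      by (rule inv_into_into) (use f in \<open>simp add: bij_betw_def\<close>)
    moreover have "f (inv_into {0..<CARD('n)} f j) = j"
      using bij_betw_inv_into_right[OF f] by simp
    ultimately show ?thesis using p[of "inv_into {0..<CARD('n)} f j"] N(2) by (simp add: w_def)
  qed
  have "w i \<noteq> 0"
  proof
    assume "w i = 0"
    then have "of_int q * \<bar>u i\<bar> < \<bar>u i\<bar>"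
      using w[of i] q by (simp add: abs_mult \<delta>_def)
    moreover have "1 * \<bar>u i\<bar> \<le> of_int q * \<bar>u i\<bar>"
      using q by (intro mult_right_mono) auto
    ultimately show False by simp
  qed
  define d where "d = Gcd (range w)"
  have dvd: "d dvd w j" for j by (simp add: d_def)
  have "d \<ge> 0" by (simp add: d_def)
  moreover have "d \<noteq> 0" using dvd[of i] \<open>w i \<noteq> 0\<close> by auto
  ultimately have d: "d > 0" by simp
  define P where "P = {j. odd (w j div d)}"
  have "P \<noteq> {}"
  proof
    assume "P = {}"
    then have "2 * d dvd w j" for j
    proof -
      have "2 dvd w j div d" using \<open>P = {}\<close> by (auto simp: P_def)
      then have "2 * d dvd (w j div d) * d" by (rule mult_dvd_mono) simp
      then show ?thesis using dvd[of j] by simp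
    qed
    then have "2 * d dvd d" unfolding d_def by (intro Gcd_greatest) auto
    with d show False using zdvd_imp_le by fastforce
  qed
  moreover have "\<exists>m::int. \<bar>u j * (of_int q / of_int d) - (2 * of_int m + (if j \<in> P then 1 else 0))\<bar> < \<epsilon>" for j
  proof
    have "2 * of_int (w j div d div 2) + (if j \<in> P then 1 else 0) = (of_int (w j div d) :: real)"
    proof -
      have "2 * (w j div d div 2) + (if j \<in> P then 1 else 0) = w j div d"
        by (auto simp: P_def odd_two_times_div_two_succ)
      then have "real_of_int (2 * (w j div d div 2) + (if j \<in> P then 1 else 0)) = of_int (w j div d)"
        by (rule arg_cong)
      then show ?thesis by (simp only: of_int_add of_int_mult of_int_numeral of_int_1 of_int_0 if_distrib)
    qed
    also have "\<dots> = of_int (w j) / of_int d" using dvd[of j] d by (auto elim!: dvdE)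
    finally have "\<bar>u j * (of_int q / of_int d) - (2 * of_int (w j div d div 2) + (if j \<in> P then 1 else 0))\<bar>
      = \<bar>(of_int q * u j - of_int (w j)) / of_int d\<bar>"
      by (simp add: diff_divide_distrib mult.commute)
    also have "\<dots> = \<bar>of_int q * u j - of_int (w j)\<bar> / of_int d" using d by simp
    also have "\<dots> \<le> \<bar>of_int q * u j - of_int (w j)\<bar> / 1"
      using d by (intro divide_left_mono) auto
    also have "\<dots> < \<epsilon>" using w[of j] by (simp add: \<delta>_def)
    finally show "\<bar>u j * (of_int q / of_int d)
       - (2 * of_int (w j div d div 2) + (if j \<in> P then 1 else 0))\<bar> < \<epsilon>" .
  qed
  ultimately show ?thesis by blast
qed

text \<open>One \<open>P\<close> has to serve every \<open>\<epsilon>\<close>. There are finitely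
  many sets, so if each nonempty one failed for some tolerance, the least tolerance would contradict
  \<open>approx_half_period_at\<close>.\<close>

lemma approx_half_period:
  fixes u :: "'n :: finite \<Rightarrow> real"
  assumes "u i \<noteq> 0"
  obtains P where "P \<noteq> {}"
    "\<And>\<epsilon>. \<epsilon> > 0 \<Longrightarrow> \<exists>\<tau>. \<forall>j. \<exists>m::int. \<bar>u j * \<tau> - (2 * of_int m + (if j \<in> P then 1 else 0))\<bar> < \<epsilon>"
proof (rule ccontr)
  assume "\<not> thesis"
  \<comment> \<open>For the empty set any positive tolerance will do, such as 1.\<close>
  with that have "\<forall>P. \<exists>\<epsilon>>0. P \<noteq> {} \<longrightarrow>
      \<not> (\<exists>\<tau>. \<forall>j. \<exists>m::int. \<bar>u j * \<tau> - (2 * of_int m + (if j \<in> P then 1 else 0))\<bar> < \<epsilon>)"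
    by (metis zero_less_one)
  then obtain e where e: "\<And>P. e P > 0" "\<And>P. P \<noteq> {} \<Longrightarrow>
      \<not> (\<exists>\<tau>. \<forall>j. \<exists>m::int. \<bar>u j * \<tau> - (2 * of_int m + (if j \<in> P then 1 else 0))\<bar> < e P)"
    by metis
  define \<epsilon> where "\<epsilon> = Min (range e)"
  have le: "\<epsilon> \<le> e P" for P unfolding \<epsilon>_def by (intro Min_le) auto
  have "\<epsilon> > 0" unfolding \<epsilon>_def using e(1) by (subst Min_gr_iff) auto
  from approx_half_period_at[of u i, OF assms this] obtain P \<tau> where "P \<noteq> {}"
    "\<forall>j. \<exists>m::int. \<bar>u j * \<tau> - (2 * of_int m + (if j \<in> P then 1 else 0))\<bar> < \<epsilon>" by blast
  then show False using e(2)[of P] le[of P] by (meson less_le_trans)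
qed

lemma abs_sin_diff_le:
  fixes x y :: real
  shows "\<bar>sin x - sin y\<bar> \<le> \<bar>x - y\<bar>"
proof -
  have "\<bar>sin x - sin y\<bar> = 2 * \<bar>sin ((x - y) / 2)\<bar> * \<bar>cos ((x + y) / 2)\<bar>"
    by (simp add: sin_diff_sin abs_mult)
  also have "\<dots> \<le> 2 * \<bar>(x - y) / 2\<bar> * 1"
    by (intro mult_mono abs_sin_x_le_abs_x) auto
  finally show ?thesis by simp
qed

text \<open>Let \<open>e\<close> be the least absolute value of a sine at \<open>t\<close>. A
  half-period with phase errors below \<open>e / pi\<close> adds odd integers exactly on
  \<open>P\<close>, which negates those sines, and the errors move each sine by less than
  \<open>e\<close>.\<close>

lemma flip_signs:
  fixes u r :: "'n :: finite \<Rightarrow> real"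
  assumes "\<And>\<epsilon>. \<epsilon> > 0 \<Longrightarrow> \<exists>\<tau>. \<forall>j. \<exists>m::int. \<bar>u j * \<tau> - (2 * of_int m + (if j \<in> P then 1 else 0))\<bar> < \<epsilon>"
    and t: "\<And>j. j \<in> P \<Longrightarrow> sin (pi * (r j + u j * t)) < 0" "\<And>j. j \<notin> P \<Longrightarrow> sin (pi * (r j + u j * t)) > 0"
  shows "\<exists>t. \<forall>j. sin (pi * (r j + u j * t)) > 0"
proof -
  define e where "e = Min (range (\<lambda>j. \<bar>sin (pi * (r j + u j * t))\<bar>))"
  have le: "e \<le> \<bar>sin (pi * (r j + u j * t))\<bar>" for j
    unfolding e_def by (intro Min_le) auto
  have "sin (pi * (r j + u j * t)) \<noteq> 0" for j using t[of j] by (cases "j \<in> P") auto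
  then have "e > 0" unfolding e_def by (subst Min_gr_iff) auto
  with assms(1)[of "e / pi"] obtain \<tau> where
    \<tau>: "\<And>j. \<exists>m::int. \<bar>u j * \<tau> - (2 * of_int m + (if j \<in> P then 1 else 0))\<bar> < e / pi" by auto
  have "sin (pi * (r j + u j * (t + \<tau>))) > 0" for j
  proof -
    obtain m :: int where m: "\<bar>u j * \<tau> - (2 * of_int m + (if j \<in> P then 1 else 0))\<bar> < e / pi"
      using \<tau>[of j] by blast
    define n where "n = 2 * m + (if j \<in> P then 1 else 0)"
    have n: "\<bar>u j * \<tau> - of_int n\<bar> < e / pi" using m by (auto simp: n_def)
    define x where "x = r j + u j * t"
    define y where "y = x + (u j * \<tau> - of_int n)"
    have "\<bar>sin (pi * y) - sin (pi * x)\<bar> \<le> \<bar>pi * y - pi * x\<bar>" by (rule abs_sin_diff_le)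
    also have "\<dots> = pi * \<bar>u j * \<tau> - of_int n\<bar>" by (simp add: y_def distrib_left abs_mult)
    also have "\<dots> < e" using n by (simp add: field_simps)
    finally have close: "\<bar>sin (pi * y) - sin (pi * x)\<bar> < \<bar>sin (pi * x)\<bar>"
      using le[of j] by (simp add: x_def)
    have "r j + u j * (t + \<tau>) = of_int n + y" by (simp add: y_def x_def algebra_simps)
    then have "sin (pi * (r j + u j * (t + \<tau>))) = (if j \<in> P then - sin (pi * y) else sin (pi * y))"
      by (simp add: sin_pi_int_add) (simp add: n_def)
    then show ?thesis using close t[of j] by (auto simp: x_def split: if_splits)
  qed
  then show ?thesis by blast
qed

section \<open>Rigidity: without a strict solution the slopes are in ratio 1 : 3 : 2\<close>

text \<open>In \<open>rigid_123\<close> the intervals are the positive phases of the third sine, and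
  the progression carries common zeros of the other two.\<close>

lemma intervals_meeting_progression:
  fixes A C q x :: real
  assumes "0 < C" "3 * C \<le> 2 * A"
    and meet: "\<And>k::int. \<exists>n::int. q + 2 * of_int k * C < x + of_int n * A \<and> x + of_int n * A < q + 2 * of_int k * C + C"
  shows "A = 2 * C"
proof (rule ccontr)
  assume "A \<noteq> 2 * C"
  \<comment> \<open>The intervals drift by \<open>D\<close> per step against the progression, whose gaps leave room \<open>A - C \<ge> \<bar>D\<bar>\<close>
    around an interval, so some interval falls into a gap.\<close>
  define D where "D = 2 * C - A"
  have "D \<noteq> 0" using \<open>A \<noteq> 2 * C\<close> by (simp add: D_def)
  \<comment> \<open>For positive \<open>D\<close> this is \<open>3 * C \<le> 2 * A\<close>; for
    negative \<open>D\<close> it follows from \<open>0 < C\<close>.\<close>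
  have D: "\<bar>D\<bar> \<le> A - C" using assms by (auto simp: D_def abs_if)
  \<comment> \<open>Consecutive multiples of \<open>D\<close> are at most \<open>A - C\<close>
    apart, so one of them lies in the window of that length starting at
    \<open>x - q\<close>.\<close>
  have "\<exists>k::int. of_int k * D - (A - C) \<le> x - q \<and> x - q \<le> of_int k * D"
  proof (cases "D > 0")
    case True
    define k where "k = \<lceil>(x - q) / D\<rceil>"
    have "(x - q) / D \<le> of_int k" "of_int k - 1 \<le> (x - q) / D" unfolding k_def by linarith+
    then have "x - q \<le> of_int k * D" "(of_int k - 1) * D \<le> x - q"
      using True by (simp_all add: divide_le_eq le_divide_eq)
    then show ?thesis using D True by (intro exI[of _ k]) (auto simp: algebra_simps)
  next
    case False
    with \<open>D \<noteq> 0\<close> have neg: "D < 0" by simp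
    define k where "k = \<lfloor>(x - q) / D\<rfloor>"
    have "of_int k \<le> (x - q) / D" "(x - q) / D \<le> of_int k + 1" unfolding k_def by linarith+
    then have "x - q \<le> of_int k * D" "(of_int k + 1) * D \<le> x - q"
      using neg by (simp_all add: neg_divide_le_eq neg_le_divide_eq)
    then show ?thesis using D neg by (intro exI[of _ k]) (auto simp: algebra_simps)
  qed
  then obtain k :: int where k: "of_int k * D - (A - C) \<le> x - q" "x - q \<le> of_int k * D" by blast
  obtain n :: int where n: "q + 2 * of_int k * C < x + of_int n * A" "x + of_int n * A < q + 2 * of_int k * C + C"
    using meet by blast
  have "A > 0" using assms by linarith
  \<comment> \<open>The interval with index \<open>k\<close> fits between the terms \<open>k\<close>
    and \<open>k + 1\<close> of the progression, so \<open>n\<close> would lie strictly between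
    consecutive integers.\<close>
  have "x + of_int k * A \<le> q + 2 * of_int k * C" "q + 2 * of_int k * C + C \<le> x + (of_int k + 1) * A"
    using k unfolding D_def by (simp_all add: algebra_simps)
  then have "of_int k * A < of_int n * A" "of_int n * A < (of_int k + 1) * A"
    using n by linarith+
  then have "real_of_int k < of_int n" "real_of_int n < of_int (k + 1)"
    using \<open>A > 0\<close> by (simp_all only: mult_less_cancel_right_pos of_int_add of_int_1)
  then show False unfolding of_int_less_iff by simp
qed

lemma sin_pi_same_sign_near:
  fixes r u t :: real
  assumes "sin (pi * (r + u * t)) \<noteq> 0"
  obtains d where "d > 0"
    "\<And>h. \<bar>h\<bar> < d \<Longrightarrow> sin (pi * (r + u * (t + h))) * sin (pi * (r + u * t)) > 0"
proof -
  \<comment> \<open>The sine has Lipschitz constant \<open>pi * \<bar>u\<bar>\<close> in time;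
    adding 1 keeps the denominator positive for \<open>u = 0\<close>.\<close>
  define d where "d = \<bar>sin (pi * (r + u * t))\<bar> / (pi * (\<bar>u\<bar> + 1))"
  have "d > 0" using assms by (simp add: d_def)
  moreover have "sin (pi * (r + u * (t + h))) * sin (pi * (r + u * t)) > 0" if "\<bar>h\<bar> < d" for h
  proof -
    have "\<bar>sin (pi * (r + u * (t + h))) - sin (pi * (r + u * t))\<bar>
      \<le> \<bar>pi * (r + u * (t + h)) - pi * (r + u * t)\<bar>" by (rule abs_sin_diff_le)
    also have "\<dots> = pi * (\<bar>u\<bar> * \<bar>h\<bar>)" by (simp add: algebra_simps abs_mult)
    also have "\<dots> \<le> pi * ((\<bar>u\<bar> + 1) * \<bar>h\<bar>)" by (simp add: algebra_simps)
    also have "\<dots> < pi * ((\<bar>u\<bar> + 1) * d)"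
      using that by (intro mult_strict_left_mono) auto
    also have "\<dots> = \<bar>sin (pi * (r + u * t))\<bar>" by (simp add: d_def)
    finally show ?thesis by (auto simp: zero_less_mult_iff)
  qed
  ultimately show thesis using that by blast
qed

text \<open>The second sine changes sign at \<open>t\<close>. If the first were nonzero there, it
  would keep its sign nearby, and the product would be positive on one side of
  \<open>t\<close>.\<close>

lemma no_lone_zero:
  fixes r1 r2 r3 u1 u2 u3 t :: real
  assumes no: "\<And>t. sin (pi * (r3 + u3 * t)) > 0 \<Longrightarrow>
      sin (pi * (r1 + u1 * t)) * sin (pi * (r2 + u2 * t)) \<le> 0"
    and u2: "u2 > 0"
    and t: "sin (pi * (r3 + u3 * t)) > 0" "r2 + u2 * t \<in> \<int>"
  shows "r1 + u1 * t \<in> \<int>"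
proof (rule ccontr)
  assume "r1 + u1 * t \<notin> \<int>"
  then have nz: "sin (pi * (r1 + u1 * t)) \<noteq> 0" by (simp add: sin_pi_eq_0)
  obtain n where n: "r2 + u2 * t = of_int n" using t(2) by (elim Ints_cases)
  obtain d1 where d1: "d1 > 0"
    "\<And>h. \<bar>h\<bar> < d1 \<Longrightarrow> sin (pi * (r1 + u1 * (t + h))) * sin (pi * (r1 + u1 * t)) > 0"
    using sin_pi_same_sign_near[OF nz] by blast
  obtain d3 where d3: "d3 > 0"
    "\<And>h. \<bar>h\<bar> < d3 \<Longrightarrow> sin (pi * (r3 + u3 * (t + h))) * sin (pi * (r3 + u3 * t)) > 0"
    using sin_pi_same_sign_near[of r3 u3 t] t(1) by auto
  define h where "h = min (min d1 d3) (1 / u2) / 2"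
  have "h > 0" using d1(1) d3(1) u2 by (simp add: h_def)
  moreover have "2 * h \<le> d1" "2 * h \<le> d3" "2 * h \<le> 1 / u2" by (auto simp: h_def)
  ultimately have h: "0 < h" "h < d1" "h < d3" "u2 * h < 1"
    using u2 by (auto simp: le_divide_eq algebra_simps)
  define s where "s = sin (pi * (u2 * h))"
  have s: "s > 0" unfolding s_def using h u2 by (intro sin_pi_pos) auto
  have S2: "sin (pi * (r2 + u2 * (t + h))) = (if even n then s else - s)"
    "sin (pi * (r2 + u2 * (t - h))) = (if even n then - s else s)"
    using sin_pi_int_add[of n "u2 * h"] sin_pi_int_add[of n "- (u2 * h)"]
    by (simp_all add: n[symmetric] s_def algebra_simps)
  have p: "sin (pi * (r3 + u3 * (t + h))) > 0" "sin (pi * (r3 + u3 * (t - h))) > 0"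
    using d3(2)[of h] d3(2)[of "- h"] t(1) h by (auto simp: zero_less_mult_iff)
  show False
    using no[OF p(1)] no[OF p(2)] d1(2)[of h] d1(2)[of "- h"] h s
    unfolding S2 by (auto simp: zero_less_mult_iff mult_le_0_iff split: if_splits)
qed

text \<open>Just after a common zero the two sines have the signs given by the parities of
  \<open>m\<close> and \<open>n\<close>, so equal parities would make their product
  positive.\<close>

lemma double_zero_parity:
  fixes r1 r2 r3 u1 u2 u3 t :: real
  assumes no: "\<And>t. sin (pi * (r3 + u3 * t)) > 0 \<Longrightarrow>
      sin (pi * (r1 + u1 * t)) * sin (pi * (r2 + u2 * t)) \<le> 0"
    and u: "u1 > 0" "u2 > 0"
    and t: "sin (pi * (r3 + u3 * t)) > 0" "r1 + u1 * t = of_int m" "r2 + u2 * t = of_int n"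
  shows "odd (m + n)"
proof
  assume "even (m + n)"
  obtain d3 where d3: "d3 > 0"
    "\<And>h. \<bar>h\<bar> < d3 \<Longrightarrow> sin (pi * (r3 + u3 * (t + h))) * sin (pi * (r3 + u3 * t)) > 0"
    using sin_pi_same_sign_near[of r3 u3 t] t(1) by auto
  define h where "h = min d3 (min (1 / u1) (1 / u2)) / 2"
  have "h > 0" using d3(1) u by (simp add: h_def)
  moreover have "2 * h \<le> d3" "2 * h \<le> 1 / u1" "2 * h \<le> 1 / u2" by (auto simp: h_def)
  ultimately have h: "0 < h" "h < d3" "u1 * h < 1" "u2 * h < 1"
    using u by (auto simp: le_divide_eq algebra_simps)
  have "sin (pi * (u1 * h)) > 0" "sin (pi * (u2 * h)) > 0"
    using h u by (auto intro!: sin_pi_pos)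
  moreover have "sin (pi * (r1 + u1 * (t + h))) = (if even m then sin (pi * (u1 * h)) else - sin (pi * (u1 * h)))"
    "sin (pi * (r2 + u2 * (t + h))) = (if even n then sin (pi * (u2 * h)) else - sin (pi * (u2 * h)))"
    using sin_pi_int_add[of m "u1 * h"] sin_pi_int_add[of n "u2 * h"]
    by (simp_all add: t(2,3)[symmetric] algebra_simps)
  ultimately have "sin (pi * (r1 + u1 * (t + h))) * sin (pi * (r2 + u2 * (t + h))) > 0"
    using \<open>even (m + n)\<close> by auto
  moreover have "sin (pi * (r3 + u3 * (t + h))) > 0"
    using d3(2)[of h] t(1) h by (auto simp: zero_less_mult_iff)
  ultimately show False using no[of "t + h"] by linarith
qed

text \<open>In \<open>rigid_123\<close>, \<open>m\<close> and \<open>n\<close> are the integer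
  advances of the first and second phase between common zeros chosen in two successive positive
  phases of the third sine.\<close>

lemma small_gap_cases:
  fixes m n :: int
  assumes "0 < m" "m < n" "n < 6" "even (m + n)"
  shows "(m, n) \<in> {(1, 3), (2, 4), (1, 5), (3, 5)}"
proof -
  have "m \<in> {1, 2, 3, 4}" "n \<in> {2, 3, 4, 5}" using assms by auto
  with assms show ?thesis by auto
qed

text \<open>Three of the pairs are coprime. For (2, 4) the equation only gives
  \<open>x = 2 * y\<close>, and parity then makes \<open>y\<close> even.\<close>

lemma gap_dvd:
  fixes m n x y :: int
  assumes "(m, n) \<in> {(1, 3), (2, 4), (1, 5), (3, 5)}" "m * x = n * y" "even (x + y)"
  shows "n dvd x"
proof -
  consider "m = 1" "n = 3" | "m = 2" "n = 4" | "m = 1" "n = 5" | "m = 3" "n = 5"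
    using assms(1) by auto
  then show ?thesis
  proof cases
    case 2
    then have "x = 2 * y" using assms(2) by simp
    with 2 assms(3) show ?thesis by auto
  next
    case 4
    then have "3 * x = 5 * y" using assms(2) by simp
    with 4 show ?thesis by presburger
  qed (use assms(2) in auto)
qed

text \<open>Each positive phase of the third sine contains a zero of the second, hence a common
  zero. The ratio \<open>u1 / u2\<close> and the parities restrict the advances between such zeros
  to four pairs; comparing periods leaves one.\<close>

lemma rigid_123:
  fixes r1 r2 r3 u1 u2 u3 :: real
  assumes no: "\<And>t. sin (pi * (r3 + u3 * t)) > 0 \<Longrightarrow>
      sin (pi * (r1 + u1 * t)) * sin (pi * (r2 + u2 * t)) \<le> 0"
    and u: "0 < u1" "u1 < u2" "0 < u3" "u3 < u2" "u1 \<noteq> u3"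
  shows "u2 = 3 * u1 \<and> u3 = 2 * u1"
proof -
  \<comment> \<open>Zeros of the second sine are \<open>B\<close> apart, positive phases of the
    third last \<open>C\<close>, and \<open>q\<close> starts one of them.\<close>
  define B C q where "B = 1 / u2" and "C = 1 / u3" and "q = - r3 / u3"
  have BC: "0 < B" "B < C" using u by (auto simp: B_def C_def field_simps)
  define \<rho> where "\<rho> = u1 / u2"
  have \<rho>: "0 < \<rho>" "\<rho> < 1" using u by (auto simp: \<rho>_def)
  have pos3: "sin (pi * (r3 + u3 * t)) > 0"
    if "q + 2 * of_int k * C < t" "t < q + 2 * of_int k * C + C" for t and k :: int
  proof -
    have "of_int (2 * k) < r3 + u3 * t" "r3 + u3 * t < of_int (2 * k) + 1"
      using that u by (auto simp: q_def C_def field_simps)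
    then show ?thesis using sin_pi_sign[of "2 * k" "r3 + u3 * t"] by simp
  qed
  have step: "r1 + u1 * (t + of_int j * B) = r1 + u1 * t + of_int j * \<rho>"
    "r2 + u2 * (t + of_int j * B) = r2 + u2 * t + of_int j" for t and j :: int
    using u by (simp_all add: B_def \<rho>_def algebra_simps)
  \<comment> \<open>A longer phase would contain two consecutive zeros of the second sine. Both
    would be common zeros, making \<open>\<rho>\<close> an integer strictly between 0 and 1.\<close>
  have "C \<le> 2 * B"
  proof (rule ccontr)
    assume "\<not> C \<le> 2 * B"
    \<comment> \<open>Floor plus one, not the ceiling, puts the zero strictly after
      \<open>q\<close>, where the third sine is positive.\<close>
    define j where "j = \<lfloor>r2 + u2 * q\<rfloor> + 1"
    define t where "t = (of_int j - r2) / u2"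
    have t: "r2 + u2 * t = of_int j" using u by (simp add: t_def)
    have "of_int j > r2 + u2 * q" "of_int j \<le> r2 + u2 * q + 1" unfolding j_def by linarith+
    then have "u2 * q < u2 * t" "u2 * t \<le> u2 * q + 1" using t by linarith+
    then have "q < t" "t \<le> q + B" using u by (simp_all add: B_def field_simps)
    moreover have "t + B < q + C" using calculation \<open>\<not> C \<le> 2 * B\<close> by linarith
    ultimately have "sin (pi * (r3 + u3 * t)) > 0" "sin (pi * (r3 + u3 * (t + B))) > 0"
      using pos3[of 0 t] pos3[of 0 "t + B"] BC by auto
    moreover have "r2 + u2 * t \<in> \<int>" "r2 + u2 * (t + B) \<in> \<int>"
      using t step(2)[of t 1] by auto
    ultimately have "r1 + u1 * t \<in> \<int>" "r1 + u1 * (t + B) \<in> \<int>"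
      using no_lone_zero[OF no] u by auto
    then have "(r1 + u1 * (t + B)) - (r1 + u1 * t) \<in> \<int>" by (rule Ints_diff[rotated])
    then have "\<rho> \<in> \<int>" using step(1)[of t 1] by simp
    then obtain i where "\<rho> = of_int i" by (elim Ints_cases)
    then show False using \<rho> by simp
  qed
  have "\<exists>t i j. q + 2 * of_int k * C < t \<and> t < q + 2 * of_int k * C + C \<and>
      r1 + u1 * t = of_int i \<and> r2 + u2 * t = of_int j \<and> odd (i + j)" for k :: int
  proof -
    define x where "x = q + 2 * of_int k * C"
    define j where "j = \<lfloor>r2 + u2 * x\<rfloor> + 1"
    define t where "t = (of_int j - r2) / u2"
    have t: "r2 + u2 * t = of_int j" using u by (simp add: t_def)
    have "of_int j > r2 + u2 * x" "of_int j \<le> r2 + u2 * x + 1" unfolding j_def by linarith+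
    then have "u2 * x < u2 * t" "u2 * t \<le> u2 * x + 1" using t by linarith+
    then have "x < t" "t \<le> x + B" using u by (simp_all add: B_def field_simps)
    then have xt: "x < t" "t < x + C" using BC by auto
    then have p: "sin (pi * (r3 + u3 * t)) > 0" using pos3[of k t] by (simp add: x_def)
    then have "r1 + u1 * t \<in> \<int>" using no_lone_zero[OF no] u t by auto
    then obtain i where "r1 + u1 * t = of_int i" by (elim Ints_cases)
    then show ?thesis
      using double_zero_parity[OF no _ _ p, of i j] u t xt unfolding x_def by auto
  qed
  then obtain T I J where T: "\<And>k::int. q + 2 * of_int k * C < T k"
      "\<And>k. T k < q + 2 * of_int k * C + C"
    and I: "\<And>k. r1 + u1 * T k = of_int (I k)" and J: "\<And>k. r2 + u2 * T k = of_int (J k)"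
    and odd: "\<And>k. odd (I k + J k)"
    by metis
  have diff: "u1 * (T k - T 0) = of_int (I k - I 0)" "u2 * (T k - T 0) = of_int (J k - J 0)" for k
    using I[of k] I[of 0] J[of k] J[of 0] by (simp_all add: algebra_simps)
  have Teq: "T k = T 0 + of_int (J k - J 0) * B" for k
    using diff(2)[of k] u by (simp add: B_def field_simps)
  have IJ: "of_int (I k - I 0) = \<rho> * of_int (J k - J 0)" for k
    unfolding diff[symmetric] \<rho>_def using u by simp
  define m n where "m = I 1 - I 0" and "n = J 1 - J 0"
  \<comment> \<open>The two zeros lie in \<open>(q, q + C)\<close> and
    \<open>(q + 2 * C, q + 3 * C)\<close>; with \<open>C \<le> 2 * B\<close> this gives
    \<open>n < 6\<close>.\<close>
  have "0 < T 1 - T 0" "T 1 - T 0 < 3 * C" using T[of 0] T[of 1] BC by auto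
  then have "0 < of_int n * B" "of_int n * B < 6 * B"
    using Teq[of 1] \<open>C \<le> 2 * B\<close> unfolding n_def by linarith+
  then have n: "0 < n" "n < 6" using BC by (simp_all add: zero_less_mult_iff)
  have mn: "of_int m = \<rho> * of_int n" unfolding m_def n_def by (rule IJ)
  have "0 < \<rho> * of_int n" "\<rho> * of_int n < 1 * of_int n" using n \<rho> by simp_all
  then have m: "0 < m" "m < n" unfolding mn[symmetric] by simp_all
  have "even (m + n)" using odd[of 0] odd[of 1] by (auto simp: m_def n_def)
  with m n have cases: "(m, n) \<in> {(1, 3), (2, 4), (1, 5), (3, 5)}"
    by (intro small_gap_cases)
  \<comment> \<open>This places every \<open>T k\<close> on the progression of step
    \<open>n * B\<close> through \<open>T 0\<close>.\<close>
  have dvd: "n dvd J k - J 0" for k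
  proof -
    have "of_int (m * (J k - J 0)) = real_of_int (n * (I k - I 0))"
      unfolding of_int_mult mn IJ by simp
    then have eq: "m * (J k - J 0) = n * (I k - I 0)" by (simp only: of_int_eq_iff)
    moreover have "even ((J k - J 0) + (I k - I 0))" using odd[of 0] odd[of k] by auto
    ultimately show ?thesis using gap_dvd[OF cases] by blast
  qed
  have AC: "of_int n * B = 2 * C"
  proof (rule intervals_meeting_progression)
    show "0 < C" using BC by simp
    have "n \<ge> 3" using cases by auto
    then have "3 * B \<le> of_int n * B" using BC by simp
    then show "3 * C \<le> 2 * (of_int n * B)" using \<open>C \<le> 2 * B\<close> by linarith
    fix k :: int
    obtain l where "J k - J 0 = n * l" using dvd[of k] by (elim dvdE)
    then have "T k = T 0 + of_int l * (of_int n * B)" using Teq[of k] by (simp add: mult_ac)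
    then show "\<exists>l::int. q + 2 * of_int k * C < T 0 + of_int l * (of_int n * B) \<and>
        T 0 + of_int l * (of_int n * B) < q + 2 * of_int k * C + C"
      using T[of k] by metis
  qed
  have nu: "of_int n * u3 = 2 * u2" using AC u by (simp add: B_def C_def field_simps)
  have mu: "of_int m * u2 = of_int n * u1" using mn u by (simp add: \<rho>_def field_simps)
  have "2 * C \<le> 4 * B" using \<open>C \<le> 2 * B\<close> by simp
  then have "of_int n * B \<le> 4 * B" using AC by simp
  then have "n \<le> 4" using BC by simp
  \<comment> \<open>The bound on \<open>n\<close> excludes the pairs with \<open>n = 5\<close>, and
    (2, 4) would yield \<open>u1 = u3\<close>.\<close>
  then have "(m, n) = (1, 3)" using cases nu mu u by auto
  then show ?thesis using nu mu by auto
qed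

section \<open>Case analysis on the set of flipped runners\<close>

text \<open>The slower sine stays positive for a time \<open>1 / u1\<close>, during which the faster
  one becomes positive. Both signs survive a small shift of time, which moves the third sine off a
  possible zero.\<close>

lemma exists_pos_pos_nonzero:
  fixes r1 r2 r3 u1 u2 u3 :: real
  assumes "0 < u1" "u1 < u2" "0 < u3"
  shows "\<exists>t. sin (pi * (r1 + u1 * t)) > 0 \<and> sin (pi * (r2 + u2 * t)) > 0 \<and> sin (pi * (r3 + u3 * t)) \<noteq> 0"
proof -
  have "(1 - r1) / u1 - (- r1) / u1 = 1 / u1" by (simp add: diff_divide_distrib)
  then have len: "1 < u2 * ((1 - r1) / u1 - (- r1) / u1)" using assms by simp
  obtain t where t: "(- r1) / u1 < t" "t < (1 - r1) / u1" "sin (pi * (r2 + u2 * t)) > 0"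
    using long_interval_sin_pos[OF _ len] assms by auto
  have "0 < r1 + u1 * t" "r1 + u1 * t < 1" using t assms by (auto simp: field_simps)
  then have S1: "sin (pi * (r1 + u1 * t)) > 0" by (rule sin_pi_pos)
  obtain d1 where d1: "d1 > 0"
    "\<And>h. \<bar>h\<bar> < d1 \<Longrightarrow> sin (pi * (r1 + u1 * (t + h))) * sin (pi * (r1 + u1 * t)) > 0"
    using sin_pi_same_sign_near[of r1 u1 t] S1 by auto
  obtain d2 where d2: "d2 > 0"
    "\<And>h. \<bar>h\<bar> < d2 \<Longrightarrow> sin (pi * (r2 + u2 * (t + h))) * sin (pi * (r2 + u2 * t)) > 0"
    using sin_pi_same_sign_near[of r2 u2 t] t(3) by auto
  define h where "h = min (min d1 d2) (1 / u3) / 2"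
  have "h > 0" using d1(1) d2(1) assms by (simp add: h_def)
  moreover have "2 * h \<le> d1" "2 * h \<le> d2" "2 * h \<le> 1 / u3" by (auto simp: h_def)
  ultimately have h: "0 < h" "h < d1" "h < d2" "u3 * h < 1"
    using assms by (auto simp: le_divide_eq algebra_simps)
  show ?thesis
  proof (cases "sin (pi * (r3 + u3 * t)) = 0")
    case True
    then obtain n where "r3 + u3 * t = of_int n" unfolding sin_pi_eq_0 by (elim Ints_cases)
    then have "r3 + u3 * (t + h) = of_int n + u3 * h" by (simp add: algebra_simps)
    then have "sin (pi * (r3 + u3 * (t + h))) \<noteq> 0"
      using sin_pi_pos[of "u3 * h"] h assms by (simp add: sin_pi_int_add)
    moreover have "sin (pi * (r1 + u1 * (t + h))) > 0" "sin (pi * (r2 + u2 * (t + h))) > 0"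
      using d1(2)[of h] d2(2)[of h] h S1 t(3) by (auto simp: zero_less_mult_iff)
    ultimately show ?thesis by blast
  qed (use S1 t in blast)
qed

text \<open>At a time from \<open>exists_pos_pos_nonzero\<close>, the sine of \<open>k\<close> is
  either positive as well or the only negative one, and then \<open>flip\<close> applies.\<close>

lemma solvable_if_flip_one:
  fixes u r :: "'n :: finite \<Rightarrow> real"
  assumes UNIV: "UNIV = {i, j, k}" and ne: "i \<noteq> j" "i \<noteq> k" "j \<noteq> k"
    and pos: "\<And>j. u j > 0" and "u i \<noteq> u j"
    and flip: "\<And>t. (\<And>j. j \<in> {k} \<Longrightarrow> sin (pi * (r j + u j * t)) < 0) \<Longrightarrow>
      (\<And>j. j \<notin> {k} \<Longrightarrow> sin (pi * (r j + u j * t)) > 0) \<Longrightarrow> \<exists>t. \<forall>j. sin (pi * (r j + u j * t)) > 0"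
  shows "\<exists>t. \<forall>j. sin (pi * (r j + u j * t)) > 0"
proof -
  obtain t where t: "sin (pi * (r i + u i * t)) > 0" "sin (pi * (r j + u j * t)) > 0"
      "sin (pi * (r k + u k * t)) \<noteq> 0"
  proof (cases "u i < u j")
    case True
    then show ?thesis
      using exists_pos_pos_nonzero[OF pos[of i] True pos[of k], of "r i" "r j" "r k"] that by blast
  next
    case False
    with \<open>u i \<noteq> u j\<close> have "u j < u i" by simp
    then show ?thesis
      using exists_pos_pos_nonzero[OF pos[of j] _ pos[of k], of "u i" "r j" "r i" "r k"] that by blast
  qed
  have all: "x = i \<or> x = j \<or> x = k" for x using UNIV by blast
  show ?thesis
  proof (cases "sin (pi * (r k + u k * t)) > 0")
    case True
    then have "sin (pi * (r x + u x * t)) > 0" for x using t all[of x] by auto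
    then show ?thesis by blast
  next
    case False
    show ?thesis
      by (rule flip[of t]) (use t False all in \<open>force+\<close>)
  qed
qed

text \<open>By \<open>two_slow_agree\<close> all three sines share a sign at some time; if it is
  negative, \<open>flip\<close> applies.\<close>

lemma solvable_if_flip_all:
  fixes u r :: "'n :: finite \<Rightarrow> real"
  assumes UNIV: "UNIV = {i, j, k}"
    and pos: "\<And>j. u j > 0" and less: "u i < u j" "u j < u k"
    and flip: "\<And>t. (\<And>j. sin (pi * (r j + u j * t)) < 0) \<Longrightarrow> \<exists>t. \<forall>j. sin (pi * (r j + u j * t)) > 0"
  shows "\<exists>t. \<forall>j. sin (pi * (r j + u j * t)) > 0"
proof -
  obtain t where t: "sin (pi * (r i + u i * t)) * sin (pi * (r j + u j * t)) > 0"
      "sin (pi * (r i + u i * t)) * sin (pi * (r k + u k * t)) > 0"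
    using two_slow_agree(2)[OF pos less] by blast
  have all: "x = i \<or> x = j \<or> x = k" for x using UNIV by blast
  show ?thesis
  proof (cases "sin (pi * (r i + u i * t)) > 0")
    case True
    then have "sin (pi * (r x + u x * t)) > 0" for x
      using t all[of x] by (auto simp: zero_less_mult_iff)
    then show ?thesis by blast
  next
    case False
    then have "sin (pi * (r x + u x * t)) < 0" for x
      using t all[of x] by (auto simp: zero_less_mult_iff)
    then show ?thesis by (rule flip)
  qed
qed

text \<open>Equal signs of \<open>i\<close> and \<open>j\<close> while \<open>k\<close> is positive
  give a strict solution, possibly after a flip. If this never happens,
  \<open>two_slow_agree\<close> shows that \<open>k\<close> is slower than \<open>j\<close>, and
  \<open>rigid_123\<close> applies.\<close>

lemma solvable_if_flip_two:
  fixes u r :: "'n :: finite \<Rightarrow> real"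
  assumes UNIV: "UNIV = {i, j, k}" and ne: "i \<noteq> j" "i \<noteq> k" "j \<noteq> k"
    and pos: "\<And>j. u j > 0" and less: "u i < u j" and "u i \<noteq> u k" "u j \<noteq> u k"
    and flip: "\<And>t. (\<And>x. x \<in> {i, j} \<Longrightarrow> sin (pi * (r x + u x * t)) < 0) \<Longrightarrow>
      (\<And>x. x \<notin> {i, j} \<Longrightarrow> sin (pi * (r x + u x * t)) > 0) \<Longrightarrow> \<exists>t. \<forall>j. sin (pi * (r j + u j * t)) > 0"
  shows "(\<exists>t. \<forall>j. sin (pi * (r j + u j * t)) > 0) \<or>
    (\<exists>t. \<forall>j. sin (pi * (r j + u j * t)) \<ge> 0) \<and> (\<exists>g>0. range u = {g, 2 * g, 3 * g})"
proof -
  have all: "x = i \<or> x = j \<or> x = k" for x using UNIV by blast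
  have solved: "\<exists>t. \<forall>j. sin (pi * (r j + u j * t)) > 0"
    if t: "sin (pi * (r i + u i * t)) * sin (pi * (r j + u j * t)) > 0" "sin (pi * (r k + u k * t)) > 0" for t
  proof (cases "sin (pi * (r i + u i * t)) > 0")
    case True
    then have "sin (pi * (r x + u x * t)) > 0" for x
      using t all[of x] by (auto simp: zero_less_mult_iff)
    then show ?thesis by blast
  next
    case False
    show ?thesis
      by (rule flip[of t]) (use t False all in \<open>force simp: zero_less_mult_iff\<close>)+
  qed
  show ?thesis
  proof (cases "(\<exists>t. \<forall>j. sin (pi * (r j + u j * t)) > 0)")
    case False
    with solved have no: "sin (pi * (r i + u i * t)) * sin (pi * (r j + u j * t)) \<le> 0"
      if "sin (pi * (r k + u k * t)) > 0" for t
      using that by (meson not_le)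
    have "\<not> u j < u k"
      using two_slow_agree(1)[OF pos less, of "u k" "r i" "r j" "r k"] no by (meson not_le)
    with \<open>u j \<noteq> u k\<close> have "u k < u j" by simp
    from rigid_123[OF no pos less pos this \<open>u i \<noteq> u k\<close>]
    have "u j = 3 * u i" "u k = 2 * u i" by auto
    then have "range u = {u i, 2 * u i, 3 * u i}" unfolding UNIV by auto
    moreover have "\<exists>t. \<forall>x. sin (pi * (r x + u x * t)) \<ge> 0"
    proof -
      \<comment> \<open>A positive phase of \<open>k\<close> starts at \<open>- r k / u k\<close>
        and lasts \<open>1 / u k\<close>. The phase of \<open>j\<close> reaches its next integer
        \<open>n\<close> within it because \<open>u j > u k\<close>.\<close>
      define n where "n = \<lfloor>r j + u j * (- r k / u k)\<rfloor> + 1"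
      define t where "t = (of_int n - r j) / u j"
      have t: "r j + u j * t = of_int n" using pos[of j] by (simp add: t_def)
      have "of_int n > r j + u j * (- r k / u k)" "of_int n \<le> r j + u j * (- r k / u k) + 1"
        unfolding n_def by linarith+
      then have "u j * 0 < u j * (t + r k / u k)" "u j * (t + r k / u k) \<le> 1"
        using t by (auto simp: algebra_simps)
      moreover have "1 < u j * (1 / u k)" using \<open>u k < u j\<close> pos[of k] by simp
      ultimately have "u j * 0 < u j * (t + r k / u k)" "u j * (t + r k / u k) < u j * (1 / u k)"
        by linarith+
      then have "0 < t + r k / u k" "t + r k / u k < 1 / u k"
        using pos[of j] by (simp_all only: mult_less_cancel_left_pos)
      then have "0 < u k * (t + r k / u k)" "u k * (t + r k / u k) < 1"
        using pos[of k] by (simp_all add: pos_less_divide_eq mult.commute)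
      then have "0 < r k + u k * t" "r k + u k * t < 1"
        using pos[of k] by (simp_all add: distrib_left add.commute)
      then have Sk: "sin (pi * (r k + u k * t)) > 0" by (rule sin_pi_pos)
      have "r i + u i * t \<in> \<int>"
        using no_lone_zero[OF no pos Sk] t by auto
      then have "sin (pi * (r i + u i * t)) = 0" "sin (pi * (r j + u j * t)) = 0"
        using t unfolding sin_pi_eq_0 by auto
      with Sk have "sin (pi * (r x + u x * t)) \<ge> 0" for x
        using all[of x] by auto
      then show ?thesis by blast
    qed
    ultimately show ?thesis using pos[of i] by blast
  qed blast
qed

lemma nonempty_subset_triple_cases:
  assumes "P \<subseteq> {a, b, c}" "P \<noteq> {}"
  shows "P = {a} \<or> P = {b} \<or> P = {c} \<or> P = {a, b} \<or> P = {a, c} \<or> P = {b, c} \<or> P = {a, b, c}"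
proof -
  have "P \<in> Pow {a, b, c}" using assms(1) by simp
  then show ?thesis using assms(2) by (auto simp: Pow_insert)
qed

lemma solvable_or_123:
  fixes u r :: "3 \<Rightarrow> real"
  assumes pos: "\<And>j. u j > 0" and "inj u"
  shows "(\<exists>t. \<forall>j. sin (pi * (r j + u j * t)) > 0) \<or>
    (\<exists>t. \<forall>j. sin (pi * (r j + u j * t)) \<ge> 0) \<and> (\<exists>g>0. range u = {g, 2 * g, 3 * g})"
proof -
  have "u 1 \<noteq> 0" using pos[of 1] by simp
  then obtain P where P: "P \<noteq> {}" and half:
    "\<And>\<epsilon>. \<epsilon> > 0 \<Longrightarrow> \<exists>\<tau>. \<forall>j. \<exists>m::int. \<bar>u j * \<tau> - (2 * of_int m + (if j \<in> P then 1 else 0))\<bar> < \<epsilon>"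
    using approx_half_period[of u] by blast
  have flip: "\<exists>t. \<forall>j. sin (pi * (r j + u j * t)) > 0"
    if "\<And>x. x \<in> P \<Longrightarrow> sin (pi * (r x + u x * t)) < 0"
      "\<And>x. x \<notin> P \<Longrightarrow> sin (pi * (r x + u x * t)) > 0" for t
    by (rule flip_signs[where P = P and t = t], erule half, erule that(1), erule that(2))
  have ne: "u x \<noteq> u y" if "x \<noteq> y" for x y using \<open>inj u\<close> that by (meson injD)
  have one: ?thesis if "UNIV = {i, j, k}" "i \<noteq> j" "i \<noteq> k" "j \<noteq> k" "P = {k}" for i j k
  proof (rule disjI1, rule solvable_if_flip_one[OF that(1-4) pos ne[OF that(2)]])
    fix t
    assume neg: "\<And>x. x \<in> {k} \<Longrightarrow> sin (pi * (r x + u x * t)) < 0"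
      and pos': "\<And>x. x \<notin> {k} \<Longrightarrow> sin (pi * (r x + u x * t)) > 0"
    show "\<exists>t. \<forall>j. sin (pi * (r j + u j * t)) > 0"
      by (rule flip[unfolded \<open>P = {k}\<close>]) (erule neg, erule pos')
  qed
  have two': ?thesis if "UNIV = {i, j, k}" "i \<noteq> j" "i \<noteq> k" "j \<noteq> k" "P = {i, j}" "u i < u j" for i j k
  proof (rule solvable_if_flip_two[OF that(1-4) pos that(6) ne[OF that(3)] ne[OF that(4)]])
    fix t
    assume neg: "\<And>x. x \<in> {i, j} \<Longrightarrow> sin (pi * (r x + u x * t)) < 0"
      and pos': "\<And>x. x \<notin> {i, j} \<Longrightarrow> sin (pi * (r x + u x * t)) > 0"
    show "\<exists>t. \<forall>j. sin (pi * (r j + u j * t)) > 0"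
      by (rule flip[unfolded \<open>P = {i, j}\<close>]) (erule neg, erule pos')
  qed
  have two: ?thesis if "UNIV = {i, j, k}" "i \<noteq> j" "i \<noteq> k" "j \<noteq> k" "P = {i, j}" for i j k
  proof (cases "u i < u j")
    case False
    then have "u j < u i" using ne[OF that(2)] by simp
    with that show ?thesis by (intro two'[of j i k]) auto
  qed (rule two'[OF that])
  have three: ?thesis if "UNIV = {i, j, k}" "P = UNIV" "u i < u j" "u j < u k" for i j k
  proof (rule disjI1, rule solvable_if_flip_all[OF that(1) pos that(3,4)])
    fix t
    assume "\<And>x. sin (pi * (r x + u x * t)) < 0"
    then show "\<exists>t. \<forall>j. sin (pi * (r j + u j * t)) > 0"
      by (intro flip[of t]) (simp_all add: \<open>P = UNIV\<close>)
  qed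
  \<comment> \<open>Every ordering of the runners, so that any of them can take the roles of
    \<open>i\<close>, \<open>j\<close> and \<open>k\<close>.\<close>
  have U: "UNIV = {1::3, 2, 3}" "UNIV = {1::3, 3, 2}" "UNIV = {2::3, 1, 3}"
    "UNIV = {2::3, 3, 1}" "UNIV = {3::3, 1, 2}" "UNIV = {3::3, 2, 1}"
    using UNIV_3 by auto
  have "P \<subseteq> {1, 2, 3}" unfolding U(1)[symmetric] by simp
  then consider "P = {1}" | "P = {2}" | "P = {3}" | "P = {1, 2}" | "P = {1, 3}" | "P = {2, 3}" | "P = {1, 2, 3}"
    by (rule nonempty_subset_triple_cases[OF _ P, THEN disjE]) blast+
  then show ?thesis
  proof cases
    case 7
    then have PU: "P = UNIV" using U by simp
    have "u 1 \<noteq> u 2" "u 1 \<noteq> u 3" "u 2 \<noteq> u 3" by (intro ne; simp)+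
    then consider "u 1 < u 2" "u 2 < u 3" | "u 1 < u 3" "u 3 < u 2" | "u 2 < u 1" "u 1 < u 3"
      | "u 2 < u 3" "u 3 < u 1" | "u 3 < u 1" "u 1 < u 2" | "u 3 < u 2" "u 2 < u 1"
      by linarith
    then show ?thesis
    proof cases
      case 1 then show ?thesis by (rule three[OF U(1) PU])
    next
      case 2 then show ?thesis by (rule three[OF U(2) PU])
    next
      case 3 then show ?thesis by (rule three[OF U(3) PU])
    next
      case 4 then show ?thesis by (rule three[OF U(4) PU])
    next
      case 5 then show ?thesis by (rule three[OF U(5) PU])
    next
      case 6 then show ?thesis by (rule three[OF U(6) PU])
    qed
  next
    case 1 show ?thesis by (rule one[OF U(4) _ _ _ 1]) simp_all
  next
    case 2 show ?thesis by (rule one[OF U(2) _ _ _ 2]) simp_all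
  next
    case 3 show ?thesis by (rule one[OF U(1) _ _ _ 3]) simp_all
  next
    case 4 show ?thesis by (rule two[OF U(1) _ _ _ 4]) simp_all
  next
    case 5 show ?thesis by (rule two[OF U(2) _ _ _ 5]) simp_all
  next
    case 6 show ?thesis by (rule two[OF U(4) _ _ _ 6]) simp_all
  qed
qed

section \<open>Return to distances and extremal velocity vectors\<close>

text \<open>For \<open>\<bar>y\<bar>\<close> in [0, 1/4], [1/4, 5/12] and [3/8, 1/2] the multiplier
  1, 3 and 2 respectively works, and these intervals cover [0, 1/2].\<close>

lemma multiples_123_not_lonely:
  "\<exists>m\<in>{1, 2, 3::int}. nearest_int_dist (of_int m * x) \<le> 1 / 4"
proof -
  define y where "y = x - of_int (round x)"
  have y: "\<bar>y\<bar> \<le> 1 / 2"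
    using of_int_round_abs_le[of x] by (simp add: y_def abs_minus_commute)
  have le: "nearest_int_dist z \<le> \<bar>z - of_int n\<bar>" for z n
    unfolding nearest_int_dist_def by (rule round_diff_minimal)
  have "nearest_int_dist (of_int m * x) \<le> \<bar>of_int m * y - of_int n\<bar>" for m n
    using le[of "of_int m * x" "m * round x + n"] by (simp add: y_def algebra_simps)
  from this[of 1 0] this[of 2 1] this[of 2 "-1"] this[of 3 1] this[of 3 "-1"]
  have "nearest_int_dist x \<le> \<bar>y\<bar>" "nearest_int_dist (2 * x) \<le> \<bar>2 * y - 1\<bar>"
    "nearest_int_dist (2 * x) \<le> \<bar>2 * y + 1\<bar>" "nearest_int_dist (3 * x) \<le> \<bar>3 * y - 1\<bar>"
    "nearest_int_dist (3 * x) \<le> \<bar>3 * y + 1\<bar>" by simp_all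
  then have "nearest_int_dist x \<le> 1 / 4 \<or> nearest_int_dist (2 * x) \<le> 1 / 4 \<or> nearest_int_dist (3 * x) \<le> 1 / 4"
    using y by linarith
  then show ?thesis by auto
qed

text \<open>The disjunction serves both halves of the final theorem: each case contains a weak
  solution, and starting points that witness extremality admit only the second case.\<close>

lemma lonely_runner_three:
  fixes v s :: "real ^ 3"
  assumes "\<forall>j. v $ j \<noteq> 0" "\<forall>i j. i \<noteq> j \<longrightarrow> v $ i \<noteq> v $ j"
    "\<forall>i j. i \<noteq> j \<longrightarrow> v $ i \<noteq> - (v $ j)"
  shows "(\<exists>t. \<forall>j. nearest_int_dist (s $ j + t * v $ j) > 1 / 4) \<or>
    (\<exists>t. \<forall>j. nearest_int_dist (s $ j + t * v $ j) \<ge> 1 / 4) \<and>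
    (\<exists>g>0. range (\<lambda>j. 2 * \<bar>v $ j\<bar>) = {g, 2 * g, 3 * g})"
proof -
  note nz = assms(1)[rule_format] and ne = assms(2,3)[rule_format]
  \<comment> \<open>The distance to the nearest integer is even, so runners with negative velocity
    are reflected to make all slopes positive.\<close>
  define r where "r j = 2 * sgn (v $ j) * s $ j - 1 / 2" for j
  define u where "u j = 2 * \<bar>v $ j\<bar>" for j
  have "u j > 0" for j using nz by (simp add: u_def)
  moreover have "inj u" using ne by (force simp: inj_on_def u_def abs_eq_iff)
  moreover have "sin (pi * (2 * (s $ j + t * v $ j) - 1 / 2)) = sin (pi * (r j + u j * t))" for j t
  proof (cases "v $ j > 0")
    case False
    with nz[of j] have "v $ j < 0" by (simp add: less_le)
    then have "r j + u j * t = - (2 * (s $ j + t * v $ j)) - 1 / 2"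
      by (simp add: r_def u_def algebra_simps)
    moreover have "sin (pi * (x - 1 / 2)) = sin (pi * (- x - 1 / 2))" for x
      by (simp add: right_diff_distrib sin_diff)
    ultimately show ?thesis by metis
  qed (simp add: r_def u_def algebra_simps)
  ultimately show ?thesis
    using solvable_or_123[of u r] unfolding nearest_int_dist_sin by (simp add: u_def)
qed

lemma extremal_if_123:
  assumes "eq_up_to_scaling_permuting v (vector [1, 2, 3])"
  shows "extremal v"
proof -
  obtain c \<sigma> where \<sigma>: "\<sigma> permutes UNIV"
    and v: "\<And>j. real_of_int (v $ j) = c * real_of_int ((vector [1, 2, 3] :: int ^ 3) $ \<sigma> j)"
    using assms by (auto simp: eq_up_to_scaling_permuting_def)
  \<comment> \<open>All runners start at 0, so at time \<open>t\<close> their positions are 1, 2 and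
    3 times \<open>t * c\<close>.\<close>
  have "\<exists>j. nearest_int_dist ((0 :: real ^ 3) $ j + t * of_int (v $ j)) \<le> 1 / 4" for t
  proof -
    obtain m :: int where m: "m \<in> {1, 2, 3}" "nearest_int_dist (of_int m * (t * c)) \<le> 1 / 4"
      using multiples_123_not_lonely by blast
    then have "m = (vector [1, 2, 3] :: int ^ 3) $ 1 \<or> m = (vector [1, 2, 3] :: int ^ 3) $ 2
        \<or> m = (vector [1, 2, 3] :: int ^ 3) $ 3"
      by auto
    then obtain l where l: "m = (vector [1, 2, 3] :: int ^ 3) $ l" by blast
    obtain j where "l = \<sigma> j" using \<sigma> by (meson permutes_surj surjD)
    with l m(2) v[of j] show ?thesis by (intro exI[of _ j]) (simp add: mult_ac)
  qed
  then show ?thesis unfolding extremal_def by (meson not_le)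
qed

lemma eq_123_if_extremal:
  assumes "velocity_vector v" "extremal v"
  shows "eq_up_to_scaling_permuting v (vector [1, 2, 3])"
proof -
  define w where "w = (\<chi> j. real_of_int (v $ j))"
  have pos: "w $ j > 0" for j using assms(1) by (simp add: w_def velocity_vector_def)
  have ne: "\<forall>i j. i \<noteq> j \<longrightarrow> w $ i \<noteq> w $ j"
    using assms(1) by (auto simp: w_def velocity_vector_def)
  have "w $ i \<noteq> - (w $ j)" for i j using pos[of i] pos[of j] by linarith
  then have ne': "\<forall>i j. i \<noteq> j \<longrightarrow> w $ i \<noteq> - (w $ j)" by blast
  have nz: "\<forall>j. w $ j \<noteq> 0" using pos by (simp add: less_le)
  obtain s :: "real ^ 3" where "\<nexists>t. \<forall>j. nearest_int_dist (s $ j + t * w $ j) > 1 / 4"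
    using assms(2) by (auto simp: extremal_def w_def)
  then obtain g where g: "g > 0" "range (\<lambda>j. 2 * \<bar>w $ j\<bar>) = {g, 2 * g, 3 * g}"
    using lonely_runner_three[OF nz ne ne', of s] by auto
  \<comment> \<open>The factor \<open>g / 2\<close> undoes the doubling of velocities into
    slopes.\<close>
  have "\<exists>l. w $ j = g / 2 * of_int ((vector [1, 2, 3] :: int ^ 3) $ l)" for j
  proof -
    have "2 * \<bar>w $ j\<bar> \<in> {g, 2 * g, 3 * g}" using g(2) by blast
    then have "w $ j = g / 2 * of_int ((vector [1, 2, 3] :: int ^ 3) $ 1) \<or>
      w $ j = g / 2 * of_int ((vector [1, 2, 3] :: int ^ 3) $ 2) \<or>
      w $ j = g / 2 * of_int ((vector [1, 2, 3] :: int ^ 3) $ 3)"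
      using pos[of j] by auto
    then show ?thesis by blast
  qed
  then obtain \<sigma> where \<sigma>: "\<And>j. w $ j = g / 2 * of_int ((vector [1, 2, 3] :: int ^ 3) $ \<sigma> j)"
    by metis
  \<comment> \<open>Equal indices would give equal velocities; on a finite type injectivity suffices
    for a permutation.\<close>
  have "inj \<sigma>" using \<sigma> ne by (metis injI)
  then have "bij \<sigma>" by (simp add: bij_def finite_UNIV_inj_surj)
  then have "\<sigma> permutes UNIV" by (intro bij_imp_permutes) auto
  then show ?thesis
    unfolding eq_up_to_scaling_permuting_def using \<sigma> g(1)
    by (intro exI[of _ "g / 2"] conjI exI[of _ \<sigma>]) (auto simp: w_def)
qed

theorem theorem4p8:
  shows "(\<forall>(v :: real ^ 3) (s :: real ^ 3).
            (\<forall>j. v $ j \<noteq> 0) \<and>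
            (\<forall>i j. i \<noteq> j \<longrightarrow> v $ i \<noteq> v $ j) \<and>
            (\<forall>i j. i \<noteq> j \<longrightarrow> v $ i \<noteq> - (v $ j)) \<longrightarrow>
            (\<exists>t :: real. \<forall>j. nearest_int_dist (s $ j + t * v $ j) \<ge> 1 / 4)) \<and>
         (\<forall>v :: int ^ 3. velocity_vector v \<longrightarrow>
            (extremal v \<longleftrightarrow> eq_up_to_scaling_permuting v (vector [1, 2, 3])))"
proof (intro conjI allI impI iffI)
  fix v s :: "real ^ 3"
  assume *: "(\<forall>j. v $ j \<noteq> 0) \<and> (\<forall>i j. i \<noteq> j \<longrightarrow> v $ i \<noteq> v $ j) \<and>
    (\<forall>i j. i \<noteq> j \<longrightarrow> v $ i \<noteq> - (v $ j))"
  from lonely_runner_three[OF *[THEN conjunct1] *[THEN conjunct2, THEN conjunct1]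
      *[THEN conjunct2, THEN conjunct2], of s]
  show "\<exists>t. \<forall>j. nearest_int_dist (s $ j + t * v $ j) \<ge> 1 / 4"
  proof (elim disjE conjE)
    assume "\<exists>t. \<forall>j. nearest_int_dist (s $ j + t * v $ j) > 1 / 4"
    then show ?thesis by (meson less_imp_le)
  qed
next
  fix v :: "int ^ 3"
  assume "velocity_vector v"
  then show "eq_up_to_scaling_permuting v (vector [1, 2, 3])" if "extremal v"
    using that by (rule eq_123_if_extremal)
  show "extremal v" if "eq_up_to_scaling_permuting v (vector [1, 2, 3])"
    using that by (rule extremal_if_123)
qed

end
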